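(* Let a triangle be an inscribed triangle with exactly two completely inscribed angles (such a triangle has exactly one side of slope $\pm1$). If the triangle has a taxicab excircle at each of its three sides, then of its two non-diagonal sides one is steep and the other is shallow.
   Context: All triangles are non-degenerate and lie in $\mathbb{R}^2$ with the taxicab distance $d((x_1,y_1),(x_2,y_2))=|x_1-x_2|+|y_1-y_2|$. A taxicab circle of center $P$ and radius $r>0$ is $\{Q: d(P,Q)=r\}$ (a square with sides of slope $\pm1$); its closed disk is $\{Q:d(P,Q)\le r\}$. A side is diagonal if its slope is $\pm1$, shallow if its slope has absolute value $<1$, and steep if it is vertical or its slope has absolute value $>1$. Inscribed angles: an angle (of a triangle) with vertex $V$ is positively inscribed if the line of slope $+1$ through $V$ does not meet the interior of the angle, and negatively inscribed if the line of slope $-1$ through $V$ does not meet the interior of the angle. It is completely inscribed if it is both positively and negatively inscribed, and inscribed if it is at least one of the two. A triangle is an inscribed triangle if all of its angles are inscribed. Excircles: an excircle of a triangle at a side is a taxicab circle outside the triangle that is tangent to that side and tangent to both rays forming the angle of the triangle opposite that side. Precisely, for the side $\overline{AB}$ of $\triangle ABC$: its closed disk lies in the closed angular region $\angle ACB$ and in the closed half-plane bounded by line $AB$ not containing $C$, and the circle has at least one point in common with the segment $\overline{AB}$, with the ray from $C$ through $A$, and with the ray from $C$ through $B$ (contact may be at a corner of the circle, along a segment, or at a vertex of the triangle). *)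

theory Defs
  imports "HOL-Analysis.Analysis"
begin

type_synonym point = "real \<times> real"

definition taxi_dist :: "point \<Rightarrow> point \<Rightarrow> real" where
  "taxi_dist P Q = \<bar>fst P - fst Q\<bar> + \<bar>snd P - snd Q\<bar>"

definition taxi_circle :: "point \<Rightarrow> real \<Rightarrow> point set" where
  "taxi_circle P r = {Q. taxi_dist P Q = r}"

definition taxi_disk :: "point \<Rightarrow> real \<Rightarrow> point set" where
  "taxi_disk P r = {Q. taxi_dist P Q \<le> r}"

definition triangle :: "point \<Rightarrow> point \<Rightarrow> point \<Rightarrow> bool" where
  "triangle A B C \<longleftrightarrow> \<not> collinear {A, B, C}"

text \<open>Division by zero yields zero, so the slope is only meaningful for segments that are not
  vertical; verticality is treated separately below.\<close>

definition slope :: "point \<Rightarrow> point \<Rightarrow> real" where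
  "slope P Q = (snd Q - snd P) / (fst Q - fst P)"

definition vertical :: "point \<Rightarrow> point \<Rightarrow> bool" where
  "vertical P Q \<longleftrightarrow> fst P = fst Q"

definition diagonal :: "point \<Rightarrow> point \<Rightarrow> bool" where
  "diagonal P Q \<longleftrightarrow> \<not> vertical P Q \<and> (slope P Q = 1 \<or> slope P Q = -1)"

definition shallow :: "point \<Rightarrow> point \<Rightarrow> bool" where
  "shallow P Q \<longleftrightarrow> \<not> vertical P Q \<and> \<bar>slope P Q\<bar> < 1"

definition steep :: "point \<Rightarrow> point \<Rightarrow> bool" where
  "steep P Q \<longleftrightarrow> vertical P Q \<or> \<bar>slope P Q\<bar> > 1"

definition ray :: "point \<Rightarrow> point \<Rightarrow> point set" where
  "ray V P = {V + t *\<^sub>R (P - V) | t. t \<ge> 0}"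

text \<open>The vertex of an angle is always the first argument. The region below is the closed convex
  angle provided that \<open>V\<close>, \<open>P\<close>, \<open>Q\<close> are not collinear.\<close>

definition angular_region :: "point \<Rightarrow> point \<Rightarrow> point \<Rightarrow> point set" where
  "angular_region V P Q = {V + s *\<^sub>R (P - V) + t *\<^sub>R (Q - V) | s t. s \<ge> 0 \<and> t \<ge> 0}"

definition line_with_slope :: "real \<Rightarrow> point \<Rightarrow> point set" where
  "line_with_slope m V = {V + t *\<^sub>R (1, m) | t. True}"

definition positively_inscribed :: "point \<Rightarrow> point \<Rightarrow> point \<Rightarrow> bool" where
  "positively_inscribed V P Q \<longleftrightarrow> line_with_slope 1 V \<inter> interior (angular_region V P Q) = {}"

definition negatively_inscribed :: "point \<Rightarrow> point \<Rightarrow> point \<Rightarrow> bool" where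
  "negatively_inscribed V P Q \<longleftrightarrow> line_with_slope (-1) V \<inter> interior (angular_region V P Q) = {}"

definition completely_inscribed :: "point \<Rightarrow> point \<Rightarrow> point \<Rightarrow> bool" where
  "completely_inscribed V P Q \<longleftrightarrow> positively_inscribed V P Q \<and> negatively_inscribed V P Q"

definition inscribed_angle :: "point \<Rightarrow> point \<Rightarrow> point \<Rightarrow> bool" where
  "inscribed_angle V P Q \<longleftrightarrow> positively_inscribed V P Q \<or> negatively_inscribed V P Q"

definition triangle_angles :: "point \<Rightarrow> point \<Rightarrow> point \<Rightarrow> (point \<times> point \<times> point) set" where
  "triangle_angles A B C = {(A, B, C), (B, C, A), (C, A, B)}"

definition inscribed_triangle :: "point \<Rightarrow> point \<Rightarrow> point \<Rightarrow> bool" where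
  "inscribed_triangle A B C \<longleftrightarrow>
     triangle A B C \<and> (\<forall>(V, P, Q) \<in> triangle_angles A B C. inscribed_angle V P Q)"

text \<open>Twice the signed area of the triangle \<open>ABX\<close>: its sign tells on which side of the line
  \<open>AB\<close> the point \<open>X\<close> lies.\<close>

definition signed_area2 :: "point \<Rightarrow> point \<Rightarrow> point \<Rightarrow> real" where
  "signed_area2 A B X =
     (fst B - fst A) * (snd X - snd A) - (snd B - snd A) * (fst X - fst A)"

definition opposite_half_plane :: "point \<Rightarrow> point \<Rightarrow> point \<Rightarrow> point set" where
  "opposite_half_plane A B C = {X. signed_area2 A B X * signed_area2 A B C \<le> 0}"

text \<open>The circle with centre \<open>P\<close> and radius \<open>r\<close> is an excircle of \<open>ABC\<close> at the side \<open>AB\<close>.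
  The opposite vertex is the last argument.\<close>

definition excircle :: "point \<Rightarrow> real \<Rightarrow> point \<Rightarrow> point \<Rightarrow> point \<Rightarrow> bool" where
  "excircle P r A B C \<longleftrightarrow>
     r > 0 \<and>
     taxi_disk P r \<subseteq> angular_region C A B \<and>
     taxi_disk P r \<subseteq> opposite_half_plane A B C \<and>
     taxi_circle P r \<inter> closed_segment A B \<noteq> {} \<and>
     taxi_circle P r \<inter> ray C A \<noteq> {} \<and>
     taxi_circle P r \<inter> ray C B \<noteq> {}"

definition has_excircle :: "point \<Rightarrow> point \<Rightarrow> point \<Rightarrow> bool" where
  "has_excircle A B C \<longleftrightarrow> (\<exists>P r. excircle P r A B C)"

end

theory Submission
  imports Defs
begin

text \<open>In the coordinates \<open>y - x\<close> and \<open>y + x\<close> taxicab disks are axis-parallel squares, and an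
  angle is positively (negatively) inscribed iff its vertex is extremal in the angle for the first
  (second) coordinate. Let \<open>P\<close>, \<open>Q\<close> carry the completely inscribed angles. The third vertex \<open>R\<close> lies
  strictly between \<open>P\<close> and \<open>Q\<close> in one coordinate, whereas in the other all three vertices are
  extremal, so two of them agree there. If these are \<open>P\<close> and \<open>Q\<close>, then \<open>PQ\<close> is diagonal and the
  other two sides have slopes of opposite type. If they are \<open>P\<close> and \<open>R\<close> (or \<open>Q\<close> and \<open>R\<close>), there is no
  excircle at \<open>PQ\<close>: the corner of its disk obtained by combining the contact points on the two rays
  from \<open>R\<close> can lie in the angle at \<open>R\<close> only if the disk contains \<open>R\<close>.\<close>

section \<open>Coordinates adapted to the taxicab metric\<close>

text \<open>The values 1 and -1 of \<open>m\<close> give the coordinates y - x and y + x. Keeping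
  \<open>m\<close> as a parameter, with \<open>- m\<close> for the other coordinate, covers both
  roles at once.\<close>

definition level :: "real \<Rightarrow> point \<Rightarrow> real" where
  "level m X = snd X - m * fst X"

lemma level_add [simp]: "level m (X + Y) = level m X + level m Y"
  and level_diff [simp]: "level m (X - Y) = level m X - level m Y"
  and level_scaleR [simp]: "level m (c *\<^sub>R X) = c * level m X"
  by (simp_all add: level_def algebra_simps)

lemma line_with_slope_iff: "X \<in> line_with_slope m V \<longleftrightarrow> level m X = level m V"
proof
  assume "X \<in> line_with_slope m V"
  then show "level m X = level m V"
    by (auto simp: line_with_slope_def level_def algebra_simps)
next
  assume "level m X = level m V"
  then have "X = V + (fst X - fst V) *\<^sub>R (1, m)"
    by (auto simp: level_def prod_eq_iff algebra_simps)
  then show "X \<in> line_with_slope m V"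
    unfolding line_with_slope_def by blast
qed

text \<open>Since |a| + |b| is the maximum of |a + b| and |a - b|, the disk is a product of two
  intervals in the level coordinates.\<close>

lemma mem_taxi_disk_iff:
  assumes "\<bar>m\<bar> = 1"
  shows "X \<in> taxi_disk P r \<longleftrightarrow>
    \<bar>level m X - level m P\<bar> \<le> r \<and> \<bar>level (- m) X - level (- m) P\<bar> \<le> r"
proof -
  have "m = 1 \<or> m = -1"
    using assms by linarith
  then show ?thesis
    by (auto simp: taxi_disk_def taxi_dist_def level_def abs_if split: if_splits)
qed

lemma point_with_levels:
  assumes "m \<noteq> 0"
  obtains X where "level m X = a" "level (- m) X = b"
proof
  show "level m ((b - a) / (2 * m), (a + b) / 2) = a"
    and "level (- m) ((b - a) / (2 * m), (a + b) / 2) = b"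
    using assms by (simp_all add: level_def field_simps)
qed

section \<open>Signed areas and the interior of an angle\<close>

lemma signed_area2_rotate: "signed_area2 A B C = signed_area2 B C A"
  by (simp add: signed_area2_def algebra_simps)

lemma signed_area2_swap: "signed_area2 B A C = - signed_area2 A B C"
  by (simp add: signed_area2_def algebra_simps)

lemma signed_area2_zero_if_level_eq:
  assumes "level m A = level m B" "level m A = level m C"
  shows "signed_area2 A B C = 0"
proof -
  have "snd B - snd A = m * (fst B - fst A)" "snd C - snd A = m * (fst C - fst A)"
    using assms by (simp_all add: level_def algebra_simps)
  then show ?thesis
    by (simp add: signed_area2_def)
qed

lemma signed_area2_nonzero_if_triangle:
  assumes "triangle A B C"
  shows "signed_area2 A B C \<noteq> 0"
proof
  assume zero: "signed_area2 A B C = 0"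
  have "B \<noteq> A"
    using assms by (auto simp: triangle_def)
  then consider "fst B \<noteq> fst A" | "snd B \<noteq> snd A"
    by (auto simp: prod_eq_iff)
  then obtain c where "C = A + c *\<^sub>R (B - A)"
  proof cases
    case 1
    moreover from this have "snd C - snd A = (fst C - fst A) / (fst B - fst A) * (snd B - snd A)"
      using zero by (simp add: signed_area2_def eq_divide_eq mult.commute)
    ultimately show ?thesis
      by (intro that[of "(fst C - fst A) / (fst B - fst A)"]) (simp add: prod_eq_iff)
  next
    case 2
    moreover from this have "fst C - fst A = (snd C - snd A) / (snd B - snd A) * (fst B - fst A)"
      using zero by (simp add: signed_area2_def eq_divide_eq mult.commute)
    ultimately show ?thesis
      by (intro that[of "(snd C - snd A) / (snd B - snd A)"]) (simp add: prod_eq_iff)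
  qed
  moreover have "A = A + 0 *\<^sub>R (B - A)" "B = A + 1 *\<^sub>R (B - A)"
    by simp_all
  ultimately have "\<forall>X\<in>{A, B, C}. \<exists>c. X = A + c *\<^sub>R (B - A)"
    by blast
  then have "collinear {A, B, C}"
    unfolding collinear_alt by blast
  then show False
    using assms by (simp add: triangle_def)
qed

lemma cramer_representation:
  assumes "signed_area2 V P Q \<noteq> 0"
  shows "X = V + (signed_area2 V X Q / signed_area2 V P Q) *\<^sub>R (P - V)
               + (signed_area2 V P X / signed_area2 V P Q) *\<^sub>R (Q - V)"
  using assms
  by (simp add: prod_eq_iff field_simps) (simp add: signed_area2_def algebra_simps)

text \<open>Positivity of both Cramer coefficients is an open condition that forces membership in
  the angle.\<close>

lemma interior_angular_region_if_pos:
  assumes nz: "signed_area2 V P Q \<noteq> 0" and "s > 0" "t > 0"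
  shows "V + s *\<^sub>R (P - V) + t *\<^sub>R (Q - V) \<in> interior (angular_region V P Q)"
proof (rule interiorI)
  let ?D = "signed_area2 V P Q"
  let ?S = "{X. 0 < signed_area2 V X Q / ?D} \<inter> {X. 0 < signed_area2 V P X / ?D}"
  show "open ?S"
    using nz unfolding signed_area2_def
    by (intro open_Int open_Collect_less continuous_intros) auto
  have "signed_area2 V (V + s *\<^sub>R (P - V) + t *\<^sub>R (Q - V)) Q = s * ?D"
    "signed_area2 V P (V + s *\<^sub>R (P - V) + t *\<^sub>R (Q - V)) = t * ?D"
    by (simp_all add: signed_area2_def algebra_simps)
  then show "V + s *\<^sub>R (P - V) + t *\<^sub>R (Q - V) \<in> ?S"
    using assms by simp
  show "?S \<subseteq> angular_region V P Q"
  proof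
    fix X assume "X \<in> ?S"
    then show "X \<in> angular_region V P Q"
      using cramer_representation[OF nz, of X] unfolding angular_region_def
      by (fastforce intro: less_imp_le)
  qed
qed

section \<open>Inscribed angles in terms of levels\<close>

lemma interior_level_halfplane:
  "interior {X. level m X * k \<ge> c} \<subseteq> {X. level m X * k > c}" if "k \<noteq> 0"
proof -
  have "{X. level m X * k \<ge> c} = {X. (- m * k, k) \<bullet> X \<ge> c}"
    "{X. level m X * k > c} = {X. (- m * k, k) \<bullet> X > c}"
    by (auto simp: level_def inner_prod_def algebra_simps)
  then show ?thesis
    using interior_halfspace_ge[of "(- m * k, k)" c] that by (simp add: prod_eq_iff)
qed

lemma line_avoids_interior_angle_iff:
  assumes "signed_area2 V P Q \<noteq> 0"
  shows "line_with_slope m V \<inter> interior (angular_region V P Q) = {} \<longleftrightarrow>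
    (level m P - level m V) * (level m Q - level m V) \<ge> 0" (is "?L \<longleftrightarrow> ?p * ?q \<ge> 0")
proof
  assume ?L
  show "?p * ?q \<ge> 0"
  proof (rule ccontr)
    assume neg: "\<not> ?p * ?q \<ge> 0"
    then have "\<bar>?q\<bar> > 0" "\<bar>?p\<bar> > 0"
      by auto
    \<comment> \<open>The weights make the level contributions of the two rays, which have opposite
      signs, cancel.\<close>
    then have "V + \<bar>?q\<bar> *\<^sub>R (P - V) + \<bar>?p\<bar> *\<^sub>R (Q - V) \<in> interior (angular_region V P Q)"
      using interior_angular_region_if_pos[OF assms] by blast
    moreover have "\<bar>?q\<bar> * ?p + \<bar>?p\<bar> * ?q = 0"
      using neg[unfolded not_le mult_less_0_iff] by (auto simp: abs_if algebra_simps)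
    then have "V + \<bar>?q\<bar> *\<^sub>R (P - V) + \<bar>?p\<bar> *\<^sub>R (Q - V) \<in> line_with_slope m V"
      by (simp add: line_with_slope_iff)
    ultimately show False
      using \<open>?L\<close> by blast
  qed
next
  assume pq: "?p * ?q \<ge> 0"
  \<comment> \<open>The sum carries the common sign of \<open>?p\<close> and \<open>?q\<close> even
    if one of them vanishes; it selects the half-plane containing the angle.\<close>
  define k where "k = ?p + ?q"
  have "\<not> (?p = 0 \<and> ?q = 0)"
    using assms by (metis signed_area2_zero_if_level_eq right_minus_eq)
  then have "k \<noteq> 0"
    using pq by (auto simp: k_def zero_le_mult_iff)
  have "angular_region V P Q \<subseteq> {X. level m X * k \<ge> level m V * k}"
  proof
    fix X assume "X \<in> angular_region V P Q"
    then obtain s t where st: "s \<ge> 0" "t \<ge> 0" "X = V + s *\<^sub>R (P - V) + t *\<^sub>R (Q - V)"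
      by (auto simp: angular_region_def)
    have "?p * k = ?p * ?p + ?p * ?q" "?q * k = ?q * ?q + ?p * ?q"
      unfolding k_def by algebra+
    then have "?p * k \<ge> 0" "?q * k \<ge> 0"
      using pq zero_le_square by (metis add_nonneg_nonneg)+
    then have "s * (?p * k) + t * (?q * k) \<ge> 0"
      using st by simp
    then show "X \<in> {X. level m X * k \<ge> level m V * k}"
      unfolding st(3) by (simp add: algebra_simps)
  qed
  then have "interior (angular_region V P Q) \<subseteq> {X. level m X * k > level m V * k}"
    using interior_mono interior_level_halfplane[OF \<open>k \<noteq> 0\<close>] by blast
  then show ?L
    by (auto simp: line_with_slope_iff)
qed

section \<open>Obstruction to an excircle\<close>

lemma has_excircle_swap: "has_excircle P Q R \<Longrightarrow> has_excircle Q P R"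
proof -
  have "angular_region R P Q = angular_region R Q P"
    unfolding angular_region_def by (auto simp: algebra_simps) (metis add.commute)+
  moreover have "opposite_half_plane P Q R = opposite_half_plane Q P R"
    by (simp add: opposite_half_plane_def signed_area2_swap[of P])
  moreover have "closed_segment P Q = closed_segment Q P"
    by (rule closed_segment_commute)
  ultimately show "has_excircle P Q R \<Longrightarrow> has_excircle Q P R"
    unfolding has_excircle_def excircle_def by metis
qed

lemma no_excircle_if_level_eq:
  assumes m: "\<bar>m\<bar> = 1" and nz: "signed_area2 P Q R \<noteq> 0"
    and eq: "level m P = level m R"
    and between: "(level (- m) P - level (- m) R) * (level (- m) Q - level (- m) R) < 0"
  shows "\<not> has_excircle P Q R"
proof
  assume "has_excircle P Q R"
  then obtain M r where exc: "excircle M r P Q R"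
    by (auto simp: has_excircle_def)
  have circle_disk: "taxi_circle M r \<subseteq> taxi_disk M r"
    by (auto simp: taxi_circle_def taxi_disk_def)
  have "taxi_disk M r \<inter> ray R P \<noteq> {}" "taxi_disk M r \<inter> ray R Q \<noteq> {}"
    using exc circle_disk unfolding excircle_def by blast+
  then obtain s t where s: "R + s *\<^sub>R (P - R) \<in> taxi_disk M r"
    and t: "t \<ge> 0" "R + t *\<^sub>R (Q - R) \<in> taxi_disk M r"
    unfolding ray_def by blast
  \<comment> \<open>\<open>Z\<close> takes its level \<open>m\<close> from the contact point on the
    ray through \<open>P\<close>, where it equals that of \<open>R\<close>, and its level
    \<open>- m\<close> from the contact point on the ray through \<open>Q\<close>. The product form
    of the disk puts \<open>Z\<close> inside it.\<close>
  obtain Z where Z: "level m Z = level m R" "level (- m) Z = level (- m) (R + t *\<^sub>R (Q - R))"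
    using point_with_levels m by (metis abs_zero zero_neq_one)
  have "Z \<in> taxi_disk M r"
    using s t(2) Z eq by (simp add: mem_taxi_disk_iff[OF m])
  then have "Z \<in> angular_region R P Q"
    using exc by (auto simp: excircle_def)
  then obtain s' t' where st': "s' \<ge> 0" "Z = R + s' *\<^sub>R (P - R) + t' *\<^sub>R (Q - R)"
    by (auto simp: angular_region_def)
  have "level m Q \<noteq> level m R"
    using nz eq signed_area2_zero_if_level_eq[of m P Q R] by auto
  then have "t' = 0"
    using st'(2) Z(1) eq by simp
  then have *: "s' * (level (- m) P - level (- m) R) = t * (level (- m) Q - level (- m) R)"
    using st'(2) Z(2) by simp
  \<comment> \<open>Otherwise the two sides of \<open>*\<close> lie on opposite sides of 0, or only
    the left one vanishes; multiplying by \<open>?q\<close> exposes the contradiction.\<close>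
  have "t = 0"
  proof (rule ccontr)
    assume "t \<noteq> 0"
    let ?p = "level (- m) P - level (- m) R" and ?q = "level (- m) Q - level (- m) R"
    have "t * ?q * ?q > 0"
      using between t(1) \<open>t \<noteq> 0\<close> by (auto simp: mult_less_0_iff zero_less_mult_iff)
    also have "t * ?q * ?q = s' * (?p * ?q)"
      using * by simp
    also have "\<dots> \<le> 0"
      using between st'(1) by (simp add: mult_nonneg_nonpos)
    finally show False
      by simp
  qed
  \<comment> \<open>The contact point is now \<open>R\<close> itself, so the disk reaches the wrong
    side of the line \<open>PQ\<close>.\<close>
  then have "R \<in> opposite_half_plane P Q R"
    using t(2) exc by (auto simp: excircle_def)
  then have "signed_area2 P Q R * signed_area2 P Q R \<le> 0"
    by (simp add: opposite_half_plane_def)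
  then show False
    using nz zero_less_mult_iff by (metis linorder_neqE_linordered_idom not_le)
qed

section \<open>Slope types from levels\<close>

lemma level_product:
  assumes "\<bar>m\<bar> = 1"
  shows "(level m P - level m Q) * (level (- m) P - level (- m) Q) =
    (snd P - snd Q)\<^sup>2 - (fst P - fst Q)\<^sup>2"
proof -
  have "m = 1 \<or> m = -1"
    using assms by linarith
  then show ?thesis
    by (auto simp: level_def power2_eq_square algebra_simps)
qed

lemma steep_if_level_product_pos:
  assumes "\<bar>m\<bar> = 1" "(level m P - level m Q) * (level (- m) P - level (- m) Q) > 0"
  shows "steep P Q" "steep Q P"
proof -
  have "\<bar>fst P - fst Q\<bar> < \<bar>snd P - snd Q\<bar>"
    using assms(2) unfolding level_product[OF assms(1)] by (simp add: abs_le_square_iff flip: not_le)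
  then show "steep P Q" "steep Q P"
    by (auto simp: steep_def vertical_def slope_def abs_minus_commute less_divide_eq)
qed

lemma shallow_if_level_product_neg:
  assumes "\<bar>m\<bar> = 1" "(level m P - level m Q) * (level (- m) P - level (- m) Q) < 0"
  shows "shallow P Q" "shallow Q P"
proof -
  have "\<bar>snd P - snd Q\<bar> < \<bar>fst P - fst Q\<bar>"
    using assms(2) unfolding level_product[OF assms(1)] by (simp add: abs_le_square_iff flip: not_le)
  then show "shallow P Q" "shallow Q P"
    by (auto simp: shallow_def vertical_def slope_def abs_minus_commute)
qed

lemma diagonal_if_level_eq:
  assumes "\<bar>m\<bar> = 1" "level m P = level m Q" "P \<noteq> Q"
  shows "diagonal P Q" "diagonal Q P"
proof -
  have eq: "snd Q - snd P = m * (fst Q - fst P)"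
    using assms(2) by (simp add: level_def algebra_simps)
  then have "fst P \<noteq> fst Q"
    using assms(3) by (auto simp: prod_eq_iff)
  then show "diagonal P Q" "diagonal Q P"
    using eq assms(1)
    by (auto simp: diagonal_def vertical_def slope_def field_simps abs_if split: if_splits)
qed

section \<open>Combining the conditions\<close>

lemma steep_and_shallow_sides:
  assumes m: "\<bar>m\<bar> = 1" and nz: "signed_area2 P Q R \<noteq> 0" and exc: "has_excircle P Q R"
    and P: "(level m Q - level m P) * (level m R - level m P) \<ge> 0"
    and Q: "(level m R - level m Q) * (level m P - level m Q) \<ge> 0"
    and R: "(level m P - level m R) * (level m Q - level m R) \<ge> 0"
    and between: "(level (- m) P - level (- m) R) * (level (- m) Q - level (- m) R) < 0"
  shows "diagonal P Q \<and> (steep Q R \<and> shallow R P \<or> steep R P \<and> shallow Q R)"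
proof -
  have "level m P \<noteq> level m R"
    using no_excircle_if_level_eq[OF m nz _ between] exc by blast
  moreover have "level m Q \<noteq> level m R"
    using no_excircle_if_level_eq[OF m, of Q P R] between nz has_excircle_swap[OF exc]
    by (auto simp: signed_area2_swap[of Q] mult.commute)
  \<comment> \<open>Three numbers, each weakly extremal among them, cannot be distinct; the
    coincidences with \<open>R\<close> have been excluded.\<close>
  ultimately have eq: "level m P = level m Q"
    using P Q R by (auto simp: zero_le_mult_iff)
  have "P \<noteq> Q"
    using nz by (auto simp: signed_area2_def)
  then have diag: "diagonal P Q"
    using diagonal_if_level_eq[OF m eq] by blast
  \<comment> \<open>By \<open>eq\<close>, \<open>?d\<close> is also the level \<open>m\<close>
    difference of \<open>P\<close> and \<open>R\<close>. The level products of the two sides at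
    \<open>R\<close> thus share this factor, while their other factors have opposite signs.\<close>
  let ?d = "level m Q - level m R"
  have "?d * (level (- m) P - level (- m) R) < 0 \<and> ?d * (level (- m) Q - level (- m) R) > 0 \<or>
    ?d * (level (- m) P - level (- m) R) > 0 \<and> ?d * (level (- m) Q - level (- m) R) < 0"
    using between \<open>level m Q \<noteq> level m R\<close> by (auto simp: mult_less_0_iff zero_less_mult_iff)
  then show ?thesis
    using diag eq steep_if_level_product_pos[OF m, of P R] steep_if_level_product_pos[OF m, of Q R]
      shallow_if_level_product_neg[OF m, of P R] shallow_if_level_product_neg[OF m, of Q R]
    by auto
qed

lemma steep_and_shallow_if_completely_inscribed:
  assumes nz: "signed_area2 P Q R \<noteq> 0" and exc: "has_excircle P Q R"
    and P: "completely_inscribed P Q R" and Q: "completely_inscribed Q R P"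
    and R: "inscribed_angle R P Q" "\<not> completely_inscribed R P Q"
  shows "\<exists>X Y Z. {X, Y, Z} = {P, Q, R} \<and> diagonal X Y \<and> steep Y Z \<and> shallow Z X"
proof -
  have nz': "signed_area2 Q R P \<noteq> 0" "signed_area2 R P Q \<noteq> 0"
    using nz signed_area2_rotate by metis+
  note iffs = completely_inscribed_def inscribed_angle_def positively_inscribed_def
    negatively_inscribed_def line_avoids_interior_angle_iff[OF nz]
    line_avoids_interior_angle_iff[OF nz'(1)] line_avoids_interior_angle_iff[OF nz'(2)]
  \<comment> \<open>Take for \<open>m\<close> the sign for which \<open>R\<close> is inscribed;
    failure of the other sign places \<open>R\<close> strictly between \<open>P\<close> and
    \<open>Q\<close> in the level \<open>- m\<close>.\<close>
  have "diagonal P Q \<and> (steep Q R \<and> shallow R P \<or> steep R P \<and> shallow Q R)"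
    using steep_and_shallow_sides[OF _ nz exc, of 1] steep_and_shallow_sides[OF _ nz exc, of "-1"]
      P Q R unfolding iffs by auto
  \<comment> \<open>Exchanging \<open>P\<close> and \<open>Q\<close> brings the second alternative
    into the cyclic order required of the witnesses.\<close>
  moreover have "diagonal Q P \<and> steep P R \<and> shallow R Q"
    if "diagonal P Q" "steep R P" "shallow Q R"
    using that by (auto simp: diagonal_def steep_def shallow_def vertical_def slope_def
        abs_minus_commute field_simps)
  ultimately show ?thesis
    by (metis insert_commute)
qed

theorem lemma3:
  fixes A B C :: point
  assumes "inscribed_triangle A B C"
    and "card {(V, P, Q) \<in> triangle_angles A B C. completely_inscribed V P Q} = 2"
    and "has_excircle A B C"
    and "has_excircle B C A"
    and "has_excircle C A B"
  shows "\<exists>P Q R. {P, Q, R} = {A, B, C} \<and> diagonal P Q \<and> steep Q R \<and> shallow R P"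
proof -
  have ins: "inscribed_angle A B C" "inscribed_angle B C A" "inscribed_angle C A B"
    and nz: "signed_area2 A B C \<noteq> 0"
    using assms(1) signed_area2_nonzero_if_triangle
    by (auto simp: inscribed_triangle_def triangle_angles_def)
  have nz': "signed_area2 B C A \<noteq> 0" "signed_area2 C A B \<noteq> 0"
    using nz signed_area2_rotate by metis+
  have distinct: "A \<noteq> B" "B \<noteq> C" "C \<noteq> A"
    using nz by (auto simp: signed_area2_def)
  \<comment> \<open>Conditional singletons let the cardinality be evaluated case by case; distinct
    vertices keep the triples apart.\<close>
  have "{(V, P, Q) \<in> triangle_angles A B C. completely_inscribed V P Q} =
    (if completely_inscribed A B C then {(A, B, C)} else {}) \<union>
    (if completely_inscribed B C A then {(B, C, A)} else {}) \<union>
    (if completely_inscribed C A B then {(C, A, B)} else {})"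
    by (auto simp: triangle_angles_def)
  then consider
      "completely_inscribed A B C" "completely_inscribed B C A" "\<not> completely_inscribed C A B"
    | "completely_inscribed B C A" "completely_inscribed C A B" "\<not> completely_inscribed A B C"
    | "completely_inscribed C A B" "completely_inscribed A B C" "\<not> completely_inscribed B C A"
    using assms(2) distinct by (auto split: if_splits)
  then show ?thesis
  \<comment> \<open>Each case rotates the triangle so that the completely inscribed vertices come
    first and takes the excircle at the side joining them.\<close>
  proof cases
    case 1
    then show ?thesis
      using steep_and_shallow_if_completely_inscribed[OF nz] ins assms(3) by blast
  next
    case 2
    then have "\<exists>P Q R. {P, Q, R} = {B, C, A} \<and> diagonal P Q \<and> steep Q R \<and> shallow R P"
      using steep_and_shallow_if_completely_inscribed[OF nz'(1)] ins assms(4) by blast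
    then show ?thesis
      by (simp add: insert_commute)
  next
    case 3
    then have "\<exists>P Q R. {P, Q, R} = {C, A, B} \<and> diagonal P Q \<and> steep Q R \<and> shallow R P"
      using steep_and_shallow_if_completely_inscribed[OF nz'(2)] ins assms(5) by blast
    then show ?thesis
      by (simp add: insert_commute)
  qed
qed

end
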